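(* Let $1<\theta<2$, $N\in\mathbb{N}$ and let $h_1,h_2,\dots,h_N$ be any $N$ real numbers such that $a<h_1<h_2<\dots<h_N<b$. Then there exists $\bar\varepsilon>0$ (sufficiently small) such that for any $\varepsilon\in(0,\bar\varepsilon)$ there exist two solutions $\varphi_1$ and $\varphi_2$ to $$Q(\varepsilon^2\varphi')'-F'(\varphi)=0\ \text{ in }(a,b),\qquad \varphi'(a)=\varphi'(b)=0,$$ satisfying $\varphi_1(a)=-1$ and $\varphi_2(a)=+1$, oscillating between $-1$ and $+1$ and between $+1$ and $-1$ respectively (touching these values), and having precisely $N$ zeros, at $h_1,h_2,\dots,h_N$.
   Context: Here $a<b$ are real and solutions are classical ($C^2$ on $[a,b]$). Assumptions on $Q$: $Q\in C^3(\mathbb{R})$, $Q(-s)=-Q(s)$ for all $s$, $\lim_{s\to\pm\infty}Q(s)=Q(0)=0$, and there is $\kappa>0$ with $Q'(s)>0$ for $s\in(-\kappa,\kappa)$ and $Q'(s)<0$ for $|s|>\kappa$. Assumptions on $F$ (with parameter $\theta$): $F\in C^1(\mathbb{R})$, $F(\pm1)=F'(\pm1)=0$, $F(u)>0$ for all $u\ne\pm1$, and there are constants $0<\lambda_1\le\lambda_2$, $\eta>0$ such that, for each choice of sign, $\lambda_1|1\pm u|^{\theta-2}\le\frac{F'(u)}{u\pm1}\le\lambda_2|1\pm u|^{\theta-2}$ for $|u\pm1|<\eta$ (understood for $u\ne\mp1$, where the quotient is defined). "Oscillating between $-1$ and $+1$ (touching these values)" means that the function takes values in $[-1,1]$ and,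 on the successive intervals into which its zeros divide $[a,b]$, attains alternately the values $-1$ and $+1$ (starting from the prescribed value at $a$). *)

theory Defs
  imports "HOL-Analysis.Analysis"
begin

(* C^k regularity on S. Derivatives are taken within S, so that on a closed interval they are
   one-sided at the endpoints; for S = UNIV this is C^k on the real line. *)
definition Ck_on :: "nat \<Rightarrow> real set \<Rightarrow> (real \<Rightarrow> real) \<Rightarrow> bool" where
  "Ck_on k S f \<longleftrightarrow>
     (\<exists>D :: nat \<Rightarrow> real \<Rightarrow> real. D 0 = f \<and>
        (\<forall>i<k. \<forall>x\<in>S. (D i has_real_derivative D (Suc i) x) (at x within S)) \<and>
        continuous_on S (D k))"

definition flux :: "(real \<Rightarrow> real) \<Rightarrow> bool" where
  "flux Q \<longleftrightarrow>
     Ck_on 3 UNIV Q \<and>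
     (\<forall>s. Q (- s) = - Q s) \<and>
     (Q \<longlongrightarrow> 0) at_top \<and> (Q \<longlongrightarrow> 0) at_bot \<and> Q 0 = 0 \<and>
     (\<exists>\<kappa>>0. (\<forall>s\<in>{-\<kappa><..<\<kappa>}. deriv Q s > 0) \<and> (\<forall>s. \<bar>s\<bar> > \<kappa> \<longrightarrow> deriv Q s < 0))"

(* The sign choice in the two growth conditions at -1 and 1 is encoded by \<sigma>. *)
definition double_well :: "real \<Rightarrow> (real \<Rightarrow> real) \<Rightarrow> bool" where
  "double_well \<theta> F \<longleftrightarrow>
     Ck_on 1 UNIV F \<and>
     F 1 = 0 \<and> F (- 1) = 0 \<and> deriv F 1 = 0 \<and> deriv F (- 1) = 0 \<and>
     (\<forall>u. u \<noteq> 1 \<and> u \<noteq> - 1 \<longrightarrow> F u > 0) \<and>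
     (\<exists>l\<^sub>1 l\<^sub>2 \<eta>. 0 < l\<^sub>1 \<and> l\<^sub>1 \<le> l\<^sub>2 \<and> 0 < \<eta> \<and>
        (\<forall>\<sigma>\<in>{1, - 1}. \<forall>u. \<bar>u + \<sigma>\<bar> < \<eta> \<and> u \<noteq> - \<sigma> \<longrightarrow>
           l\<^sub>1 * \<bar>1 + \<sigma> * u\<bar> powr (\<theta> - 2) \<le> deriv F u / (u + \<sigma>) \<and>
           deriv F u / (u + \<sigma>) \<le> l\<^sub>2 * \<bar>1 + \<sigma> * u\<bar> powr (\<theta> - 2)))"

(* Values of \<phi> outside [a,b] are irrelevant: deriv \<phi> is only used in the open interval, and the
   Neumann conditions are one-sided. *)
definition classical_solution ::
  "(real \<Rightarrow> real) \<Rightarrow> (real \<Rightarrow> real) \<Rightarrow> real \<Rightarrow> real \<Rightarrow> real \<Rightarrow> (real \<Rightarrow> real) \<Rightarrow> bool" where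
  "classical_solution Q F \<epsilon> a b \<phi> \<longleftrightarrow>
     Ck_on 2 {a..b} \<phi> \<and>
     (\<forall>x\<in>{a<..<b}. (\<lambda>y. Q (\<epsilon>\<^sup>2 * deriv \<phi> y)) differentiable (at x) \<and>
        deriv (\<lambda>y. Q (\<epsilon>\<^sup>2 * deriv \<phi> y)) x - deriv F (\<phi> x) = 0) \<and>
     (\<phi> has_real_derivative 0) (at a within {a..b}) \<and>
     (\<phi> has_real_derivative 0) (at b within {a..b})"

definition node :: "real \<Rightarrow> real \<Rightarrow> nat \<Rightarrow> (nat \<Rightarrow> real) \<Rightarrow> nat \<Rightarrow> real" where
  "node a b N h i = (if i = 0 then a else if i \<le> N then h i else b)"

definition oscillates_from ::
  "real \<Rightarrow> real \<Rightarrow> real \<Rightarrow> nat \<Rightarrow> (nat \<Rightarrow> real) \<Rightarrow> (real \<Rightarrow> real) \<Rightarrow> bool" where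
  "oscillates_from c a b N h \<phi> \<longleftrightarrow>
     \<phi> a = c \<and>
     (\<forall>x\<in>{a..b}. \<phi> x \<in> {- 1..1}) \<and>
     (\<forall>i\<le>N. \<exists>x\<in>{node a b N h i..node a b N h (Suc i)}. \<phi> x = (- 1) ^ i * c)"

end

theory Submission
  imports Defs
begin

text \<open>
The proof rests on transition layers that are constant outside a bounded interval. Multiplying the equation by \<open>\<phi>'\<close> gives
the first integral \<open>P (\<epsilon>\<^sup>2 * \<phi>') - \<epsilon>\<^sup>2 * F \<phi> = const\<close> with \<open>P' s = s * Q' s\<close>. A solution that comes
to rest in a well has constant zero, and an increasing one satisfies the autonomous equation
\<open>\<phi>' = J (\<epsilon>\<^sup>2 * F \<phi>) / \<epsilon>\<^sup>2\<close>, where \<open>J\<close> inverts \<open>P\<close> near zero (\<open>flux_inverse_energy\<close>); for small \<open>\<epsilon>\<close>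
the argument stays in the range where \<open>Q' > 0\<close>.

Since \<open>F\<close> is bounded below by the power \<open>\<theta>\<close> of the distance to the wells
(\<open>double_well_lower_bound\<close>) and \<open>J\<close> by a square root, the speed is at least a multiple of the power
\<open>\<theta> / 2\<close> of that distance, divided by \<open>\<epsilon>\<close>. As \<open>\<theta> < 2\<close>, the reciprocal of the speed is integrable up
to the wells: the layer reaches \<open>- 1\<close> and \<open>1\<close> in finite time, of order \<open>\<epsilon>\<close>, and can be continued by
these constants (\<open>heteroclinic_profile\<close>, \<open>layer_exists\<close>). Speed and acceleration vanish in the wells,
so the continuation is of class \<open>C\<^sup>2\<close>.

Once \<open>\<epsilon>\<close> is so small that a layer is narrower than the gaps between the prescribed zeros and the
endpoints, translated and alternately reflected layers can be placed at the zeros independently of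
each other and joined along intervals on which they are constant (\<open>chain_of_layers\<close>). Reflected
layers are again solutions because \<open>Q\<close> is odd.
\<close>

section \<open>Derivatives on the real line\<close>

lemma Ck_on_UNIV_deriv:
  assumes "Ck_on (Suc n) UNIV f"
  shows "(f has_real_derivative deriv f x) (at x)" and "isCont (deriv f) x"
proof -
  obtain D where D0: "D 0 = f"
    and D: "\<And>i x. i < Suc n \<Longrightarrow> (D i has_real_derivative D (Suc i) x) (at x)"
    and cont: "continuous_on UNIV (D (Suc n))"
    using assms unfolding Ck_on_def by auto
  have D1: "(f has_real_derivative D 1 x) (at x)" for x
    using D[of 0 x] D0 by simp
  then have eq: "deriv f = D 1" by (auto simp: DERIV_imp_deriv)
  show "(f has_real_derivative deriv f x) (at x)" using D1 eq by simp
  show "isCont (deriv f) x"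
  proof (cases n)
    case 0
    then show ?thesis using cont eq by (simp add: continuous_on_eq_continuous_at)
  next
    case (Suc m)
    then show ?thesis using D[of 1 x] eq by (auto intro: DERIV_isCont)
  qed
qed

text \<open>A continuous function whose derivative has a continuous extension across finitely many points is
differentiable there too, by l'Hopital's rule. This gives the regularity of a layer at the two
points where it touches the wells.\<close>

lemma has_derivative_off_finite_set:
  fixes f D :: "real \<Rightarrow> real"
  assumes "finite E" and f: "continuous_on UNIV f" and D: "continuous_on UNIV D"
    and off: "\<And>y. y \<notin> E \<Longrightarrow> (f has_real_derivative D y) (at y)"
  shows "(f has_real_derivative D x) (at x)"
proof -
  have "open (- (E - {x}))" using \<open>finite E\<close> by (intro open_Compl finite_imp_closed) auto
  then have ev: "\<forall>\<^sub>F y in at x. y \<notin> E"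
    unfolding eventually_at_topological by (intro exI[of _ "- (E - {x})"]) auto
  have "((\<lambda>y. (f y - f x) / (y - x)) \<longlongrightarrow> D x) (at x)"
  proof (rule lhopital[where f' = D and g' = "\<lambda>_. 1"])
    show "((\<lambda>y. f y - f x) \<longlongrightarrow> 0) (at x)"
      using f by (simp add: continuous_on_eq_continuous_at isCont_def LIM_zero)
    show "((\<lambda>y. y - x) \<longlongrightarrow> 0) (at x)"
      by (simp add: LIM_zero)
    show "\<forall>\<^sub>F y in at x. y - x \<noteq> 0" by (simp add: eventually_at_filter)
    show "\<forall>\<^sub>F y in at x. ((\<lambda>y. f y - f x) has_real_derivative D y) (at y)"
      using ev by eventually_elim (auto intro!: derivative_eq_intros off)
    show "((\<lambda>y. D y / 1) \<longlongrightarrow> D x) (at x)"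
      using D by (simp add: continuous_on_eq_continuous_at isCont_def)
  qed (auto intro!: derivative_eq_intros always_eventually)
  then show ?thesis by (simp add: has_field_derivative_iff)
qed

section \<open>The potential and the flux\<close>

text \<open>Near a well, integrating the lower growth condition on \<open>F'\<close> gives \<open>F u \<ge> (l / \<theta>) * r powr \<theta>\<close>, with
\<open>r\<close> the distance to the well; away from the wells \<open>F\<close> is bounded below by compactness, while the
distance to the nearer well is at most 1. The exponent \<open>\<theta>\<close> controls the speed, and hence the
travel time, of a layer.\<close>

lemma double_well_lower_bound:
  assumes "double_well \<theta> F" and "\<theta> > 0"
  obtains c where "c > 0" "\<And>u. u \<in> {- 1..1} \<Longrightarrow> c * (min (1 - u) (1 + u)) powr \<theta> \<le> F u"
proof -
  have C1: "Ck_on 1 UNIV F" and pos: "\<And>u. u \<noteq> 1 \<Longrightarrow> u \<noteq> - 1 \<Longrightarrow> F u > 0"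
    and F1: "F 1 = 0" "F (- 1) = 0"
    using assms(1) unfolding double_well_def by auto
  obtain l \<eta> where l: "l > 0" and \<eta>: "\<eta> > 0"
    and grow: "\<And>\<sigma> u. \<sigma> \<in> {1, - 1} \<Longrightarrow> \<bar>u + \<sigma>\<bar> < \<eta> \<Longrightarrow> u \<noteq> - \<sigma> \<Longrightarrow>
           l * \<bar>1 + \<sigma> * u\<bar> powr (\<theta> - 2) \<le> deriv F u / (u + \<sigma>)"
    using assms(1) unfolding double_well_def by blast
  have dF: "(F has_real_derivative deriv F u) (at u)" for u
    using Ck_on_UNIV_deriv(1)[of 0 F] C1 by simp
  have contF: "continuous_on S F" for S
    using dF by (meson DERIV_isCont continuous_at_imp_continuous_on)
  \<comment> \<open>Both wells at once: \<open>t\<close> is the distance to the well \<open>- \<sigma>\<close>, and \<open>u = \<sigma> * t - \<sigma>\<close>.\<close>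
  have near: "l / \<theta> * (1 + \<sigma> * u) powr \<theta> \<le> F u"
    if \<sigma>: "\<sigma> \<in> {1, - 1}" and u: "0 \<le> 1 + \<sigma> * u" "1 + \<sigma> * u < \<eta>" for \<sigma> u :: real
  proof -
    define t where "t = 1 + \<sigma> * u"
    define f where "f = (\<lambda>t. F (\<sigma> * t - \<sigma>) - l / \<theta> * t powr \<theta>)"
    have "f 0 \<le> f t"
    proof (rule DERIV_nonneg_imp_increasing_open[where f = f])
      show "0 \<le> t" using u t_def by simp
      show "continuous_on {0..t} f" unfolding f_def
        using \<open>\<theta> > 0\<close>
        by (intro continuous_intros continuous_on_compose2[OF contF[of UNIV]] continuous_on_powr') auto
      fix s assume s: "0 < s" "s < t"
      let ?u = "\<sigma> * s - \<sigma>"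
      have "(f has_real_derivative deriv F ?u * \<sigma> - l / \<theta> * (\<theta> * s powr (\<theta> - 1))) (at s)"
        unfolding f_def using s
        by (auto intro!: derivative_eq_intros DERIV_chain2[OF dF] has_real_derivative_powr)
      moreover have "l * s powr (\<theta> - 1) \<le> deriv F ?u * \<sigma>"
      proof -
        have "\<bar>?u + \<sigma>\<bar> < \<eta>" "?u \<noteq> - \<sigma>" "1 + \<sigma> * ?u = s"
          using \<sigma> s u t_def by auto
        then have "l * s powr (\<theta> - 2) \<le> deriv F ?u / (\<sigma> * s)"
          using grow[OF \<sigma>, of ?u] s by auto
        then have "l * s powr (\<theta> - 2) * s \<le> deriv F ?u / (\<sigma> * s) * s"
          using s by (intro mult_right_mono) auto
        moreover have "deriv F ?u / (\<sigma> * s) * s = deriv F ?u * \<sigma>"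
          using \<sigma> s by auto
        moreover have "s powr (\<theta> - 2) * s = s powr (\<theta> - 1)"
          using s powr_add[of s "\<theta> - 2" 1] by simp
        ultimately show ?thesis by (simp add: mult.assoc)
      qed
      ultimately show "\<exists>y. (f has_real_derivative y) (at s) \<and> 0 \<le> y"
        using \<open>\<theta> > 0\<close> by (intro exI[of _ "deriv F ?u * \<sigma> - l / \<theta> * (\<theta> * s powr (\<theta> - 1))"]) auto
    qed
    moreover have "f 0 = 0" using \<sigma> F1 by (auto simp: f_def)
    moreover have "\<sigma> * t - \<sigma> = u" using \<sigma> by (auto simp: t_def)
    ultimately show ?thesis by (simp add: f_def t_def)
  qed
  \<comment> \<open>Halving makes the two neighbourhoods of the wells disjoint and strictly inside the \<open>\<eta>\<close>-balls.\<close>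
  define r where "r = min \<eta> 1 / 2"
  have r: "0 < r" "r < \<eta>" "r < 1" using \<eta> by (auto simp: r_def min_def)
  obtain w where w: "w \<in> {- 1 + r..1 - r}" "\<And>u. u \<in> {- 1 + r..1 - r} \<Longrightarrow> F w \<le> F u"
    using continuous_attains_inf[of "{- 1 + r..1 - r}" F] contF r by auto
  have Fw: "F w > 0" using w(1) r by (intro pos) auto
  show thesis
  proof (rule that[of "min (l / \<theta>) (F w)"])
    show "min (l / \<theta>) (F w) > 0" using l Fw \<open>\<theta> > 0\<close> by simp
    fix u :: real assume u: "u \<in> {- 1..1}"
    let ?m = "min (1 - u) (1 + u)"
    have m: "0 \<le> ?m" "?m \<le> 1" using u by auto
    show "min (l / \<theta>) (F w) * ?m powr \<theta> \<le> F u"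
    proof (cases "?m < r")
      case True
      obtain \<sigma> :: real where \<sigma>: "\<sigma> \<in> {1, - 1}" "?m = 1 + \<sigma> * u"
        using that[of "- 1"] that[of 1] by (cases "u \<ge> 0") (auto simp: min_def)
      have "min (l / \<theta>) (F w) * ?m powr \<theta> \<le> l / \<theta> * ?m powr \<theta>"
        by (intro mult_right_mono) auto
      also have "\<dots> \<le> F u" using near[OF \<sigma>(1), of u] \<sigma>(2) True m r by simp
      finally show ?thesis .
    next
      case False
      have "min (l / \<theta>) (F w) * ?m powr \<theta> \<le> F w * 1"
        using Fw m l \<open>\<theta> > 0\<close> by (intro mult_mono powr_le1) auto
      also have "\<dots> \<le> F u" using w(2)[of u] False by (simp add: min_less_iff_disj not_less)
      finally show ?thesis .
    qed
  qed
qed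

text \<open>Multiplying the equation by \<open>\<phi>'\<close> turns its left-hand side into the derivative of
\<open>P (\<epsilon>\<^sup>2 * \<phi>') / \<epsilon>\<^sup>2\<close>, where \<open>P' s = s * Q' s\<close> and \<open>P 0 = 0\<close>. The function \<open>J\<close> is the inverse of \<open>P\<close> on
\<open>[0, \<kappa> / 2]\<close>: stopping short of \<open>\<kappa>\<close>, where \<open>Q'\<close> changes sign, keeps the equation uniformly
nondegenerate. Since \<open>P\<close> grows at most quadratically, \<open>J\<close> grows at least like a square root.\<close>

lemma flux_inverse_energy:
  assumes "flux Q"
  obtains J Y c where "Y > 0" "c > 0" "J 0 = 0" "continuous_on {0..Y} J"
    "\<And>y. y \<in> {0..Y} \<Longrightarrow> c * sqrt y \<le> J y"
    "\<And>y. y \<in> {0..Y} \<Longrightarrow> deriv Q (J y) > 0"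
    "\<And>y. 0 < y \<Longrightarrow> y < Y \<Longrightarrow> (J has_real_derivative 1 / (J y * deriv Q (J y))) (at y)"
proof -
  have C3: "Ck_on 3 UNIV Q" using assms unfolding flux_def by blast
  obtain \<kappa> where \<kappa>: "\<kappa> > 0" and Qpos: "\<And>s. s \<in> {- \<kappa><..<\<kappa>} \<Longrightarrow> deriv Q s > 0"
    using assms unfolding flux_def by blast
  have contQ': "isCont (deriv Q) s" for s
    using Ck_on_UNIV_deriv(2)[of 2 Q s] C3 by (simp add: numeral_3_eq_3 numeral_2_eq_2)
  define q where "q = \<kappa> / 2"
  have q: "0 < q" "q < \<kappa>" using \<kappa> by (auto simp: q_def)
  obtain P0 where P0: "\<And>s. (P0 has_real_derivative s * deriv Q s) (at s)"
  proof -
    have "\<exists>P. \<forall>s::real. -\<infinity> < ereal s \<longrightarrow> ereal s < \<infinity> \<longrightarrow>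
        (P has_vector_derivative s * deriv Q s) (at s)"
      by (rule einterval_antiderivative) (auto intro!: continuous_intros contQ')
    then show ?thesis using that by (auto simp: has_real_derivative_iff_has_vector_derivative)
  qed
  define P where "P = (\<lambda>s. P0 s - P0 0)"
  have P: "(P has_real_derivative s * deriv Q s) (at s)" and P_0: "P 0 = 0" for s
    unfolding P_def using P0 by (auto intro!: derivative_eq_intros)
  have contP: "continuous_on S P" for S
    using P by (meson DERIV_isCont continuous_at_imp_continuous_on)
  have mono: "P s < P t" if "0 \<le> s" "s < t" "t \<le> q" for s t
  proof (rule DERIV_pos_imp_increasing_open[OF \<open>s < t\<close> _ contP])
    fix x assume "s < x" "x < t"
    then have "x * deriv Q x > 0" using that q by (intro mult_pos_pos Qpos) auto
    then show "\<exists>y. (P has_real_derivative y) (at x) \<and> 0 < y" using P by blast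
  qed
  have inj: "inj_on P {0..q}"
    using mono by (intro linorder_inj_onI') (force simp: less_le)
  have "is_interval {0..q}" by simp
  then obtain J where J: "homeomorphism {0..q} (P ` {0..q}) P J"
    using homeomorphism_into_1d[OF _ contP refl inj] is_interval_path_connected by blast
  have img: "P ` {0..q} = {0..P q}"
  proof (intro equalityI subsetI)
    fix y assume "y \<in> P ` {0..q}"
    then obtain s where "s \<in> {0..q}" "y = P s" by auto
    then show "y \<in> {0..P q}" using mono[of 0 s] mono[of s q] P_0 by (cases "s = 0"; cases "s = q") auto
  next
    fix y assume "y \<in> {0..P q}"
    then show "y \<in> P ` {0..q}"
      using IVT'[of P 0 y q] contP P_0 q by auto
  qed
  have PJ: "P (J y) = y" and Jq: "J y \<in> {0..q}" if "y \<in> {0..P q}" for y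
    using J that unfolding homeomorphism_def img by auto
  have contJ: "continuous_on {0..P q} J" using J unfolding homeomorphism_def img by auto
  have JP: "J (P s) = s" if "s \<in> {0..q}" for s using J that unfolding homeomorphism_def by auto
  obtain z where z: "z \<in> {0..q}" "\<And>s. s \<in> {0..q} \<Longrightarrow> deriv Q s \<le> deriv Q z"
    using continuous_attains_sup[of "{0..q}" "deriv Q"] contQ' q
    by (force simp: continuous_at_imp_continuous_on)
  define M where "M = deriv Q z"
  have M: "M > 0" using z(1) q by (auto simp: M_def intro!: Qpos)
  have Pquad: "P s \<le> M / 2 * s\<^sup>2" if s: "s \<in> {0..q}" for s
  proof -
    have "M / 2 * 0\<^sup>2 - P 0 \<le> M / 2 * s\<^sup>2 - P s"
    proof (rule DERIV_nonneg_imp_nondecreasing[where f = "\<lambda>s. M / 2 * s\<^sup>2 - P s"])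
      show "0 \<le> s" using s by simp
      fix x assume x: "0 \<le> x" "x \<le> s"
      have "((\<lambda>s. M / 2 * s\<^sup>2 - P s) has_real_derivative x * (M - deriv Q x)) (at x)"
        by (auto intro!: derivative_eq_intros P simp: algebra_simps)
      moreover have "x * (M - deriv Q x) \<ge> 0" using x s z(2)[of x] by (simp add: M_def)
      ultimately show "\<exists>y. ((\<lambda>s. M / 2 * s\<^sup>2 - P s) has_real_derivative y) (at x) \<and> 0 \<le> y" by blast
    qed
    then show ?thesis using P_0 by simp
  qed
  show thesis
  proof (rule that[of "P q" "sqrt (2 / M)" J])
    show "P q > 0" using mono[of 0 q] P_0 q by simp
    show "sqrt (2 / M) > 0" using M by simp
    show "J 0 = 0" using JP[of 0] P_0 q by simp
    show "continuous_on {0..P q} J" by (rule contJ)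
    show "sqrt (2 / M) * sqrt y \<le> J y" if "y \<in> {0..P q}" for y
    proof -
      have "y \<le> M / 2 * (J y)\<^sup>2" using Pquad[OF Jq[OF that]] PJ[OF that] by simp
      then have "2 / M * y \<le> (J y)\<^sup>2" using M by (simp add: field_simps)
      then have "sqrt (2 / M * y) \<le> J y" using Jq[OF that] by (intro real_le_lsqrt) auto
      then show ?thesis using real_sqrt_mult[of "2 / M" y] by simp
    qed
    show "deriv Q (J y) > 0" if "y \<in> {0..P q}" for y
      using Jq[OF that] q by (intro Qpos) auto
    show "(J has_real_derivative 1 / (J y * deriv Q (J y))) (at y)" if y: "0 < y" "y < P q" for y
    proof -
      have "J y \<noteq> 0" using PJ[of y] P_0 y by auto
      then have nz: "J y * deriv Q (J y) \<noteq> 0" using Qpos[of "J y"] Jq[of y] y q by auto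
      have "isCont J y"
        using contJ y by (intro continuous_on_interior[of "{0..P q}"]) auto
      then have "(J has_real_derivative inverse (J y * deriv Q (J y))) (at y)"
        using y by (intro has_field_derivative_inverse_basic[where t = "{0<..<P q}" and g = J and y = y, OF P nz]) (auto intro!: PJ)
      then show ?thesis by (simp add: divide_inverse)
    qed
  qed
qed

section \<open>Heteroclinic profiles that reach their limits in finite time\<close>

lemma mono_onto_interval_imp_continuous:
  fixes f :: "real \<Rightarrow> real"
  assumes "mono f" and "{a<..<b} \<subseteq> range f" and "range f \<subseteq> {a..b}"
  shows "continuous_on UNIV f"
proof -
  have bounds: "a \<le> f x" "f x \<le> b" for x
    using subsetD[OF assms(3), of "f x"] by auto
  have "(f \<longlongrightarrow> f x) (at x)" for x
  proof (rule order_tendstoI)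
    fix l assume l: "l < f x"
    show "\<forall>\<^sub>F y in at x. l < f y"
    proof (cases "l < a")
      case True
      then show ?thesis using less_le_trans[OF _ bounds(1)] by simp
    next
      case False
      obtain u where u: "l < u" "u < f x" using dense[OF l] by blast
      then have "u \<in> {a<..<b}" using False bounds(2)[of x] by auto
      then obtain z where z: "u = f z" using assms(2) by auto
      then have "z < x" using u monoD[OF assms(1), of x z] by (meson leD leI)
      then have "\<forall>\<^sub>F y in at x. z < y"
        using order_tendstoD(1)[OF tendsto_ident_at] by blast
      then show ?thesis
      proof eventually_elim
        case (elim y)
        then show ?case using u z monoD[OF assms(1), of z y] by simp
      qed
    qed
  next
    fix l assume l: "f x < l"
    show "\<forall>\<^sub>F y in at x. f y < l"
    proof (cases "b < l")
      case True
      then show ?thesis using le_less_trans[OF bounds(2)] by simp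
    next
      case False
      obtain u where u: "f x < u" "u < l" using dense[OF l] by blast
      then have "u \<in> {a<..<b}" using False bounds(1)[of x] by auto
      then obtain z where z: "u = f z" using assms(2) by auto
      then have "x < z" using u monoD[OF assms(1), of z x] by (meson leD leI)
      then have "\<forall>\<^sub>F y in at x. y < z"
        using order_tendstoD(2)[OF tendsto_ident_at] by blast
      then show ?thesis
      proof eventually_elim
        case (elim y)
        then show ?case using u z monoD[OF assms(1), of y z] by simp
      qed
    qed
  qed
  then show ?thesis by (simp add: continuous_on_def)
qed

text \<open>\<open>G u\<close> is the time needed to travel from \<open>0\<close> to \<open>u\<close> at speed \<open>g\<close>. If \<open>g\<close> vanishes at the endpoints
no faster than a power \<open>p < 1\<close> of the distance, this time is bounded. The bound follows by comparing
\<open>G\<close> with an explicit function, whose derivative sums the contributions of the two endpoints, so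
no improper integral is required.\<close>

lemma travel_time:
  fixes g :: "real \<Rightarrow> real"
  assumes cont: "continuous_on {- 1<..<1} g"
    and "c > 0" "0 < p" "p < 1"
    and lower: "\<And>u. - 1 < u \<Longrightarrow> u < 1 \<Longrightarrow> c * (min (1 - u) (1 + u)) powr p \<le> g u"
  obtains G where "G 0 = 0"
    "\<And>u. - 1 < u \<Longrightarrow> u < 1 \<Longrightarrow> (G has_real_derivative 1 / g u) (at u)"
    "\<And>u. - 1 < u \<Longrightarrow> u < 1 \<Longrightarrow> \<bar>G u\<bar> \<le> 2 / (c * (1 - p))"
proof -
  have gpos: "g u > 0" if "- 1 < u" "u < 1" for u
    using lower[OF that] that \<open>c > 0\<close> by (auto intro: less_le_trans[rotated])
  have "isCont g u" if "- 1 < u" "u < 1" for u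
    using cont that by (simp add: continuous_on_eq_continuous_at)
  then have "isCont (\<lambda>u. 1 / g u) u" if "- 1 < u" "u < 1" for u
    using that gpos[OF that] by (intro continuous_intros) auto
  then have "\<exists>G. \<forall>u::real. ereal (- 1) < ereal u \<longrightarrow> ereal u < ereal 1 \<longrightarrow>
      (G has_vector_derivative 1 / g u) (at u)"
    by (intro einterval_antiderivative) auto
  then obtain G0 where G0: "\<And>u. - 1 < u \<Longrightarrow> u < 1 \<Longrightarrow> (G0 has_real_derivative 1 / g u) (at u)"
    by (auto simp: has_real_derivative_iff_has_vector_derivative)
  define G where "G = (\<lambda>u. G0 u - G0 0)"
  have G: "(G has_real_derivative 1 / g u) (at u)" if "- 1 < u" "u < 1" for u
    unfolding G_def using G0[OF that] by (auto intro!: derivative_eq_intros)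
  define C where "C = 1 / (c * (1 - p))"
  have C: "C > 0" using assms by (simp add: C_def)
  \<comment> \<open>The travel time of the comparison speed with \<open>1 / speed = ((1 + u) powr - p + (1 - u) powr - p) / c\<close>.\<close>
  define K where "K = (\<lambda>u. C * ((1 + u) powr (1 - p) - (1 - u) powr (1 - p)))"
  have K: "(K has_real_derivative ((1 + u) powr (- p) + (1 - u) powr (- p)) / c) (at u)"
    if "- 1 < u" "u < 1" for u
  proof -
    have "(K has_real_derivative C * ((1 - p) * (1 + u) powr (- p) + (1 - p) * (1 - u) powr (- p))) (at u)"
      unfolding K_def using that
      by (auto intro!: derivative_eq_intros DERIV_chain2[OF has_real_derivative_powr])
    moreover have "C * ((1 - p) * x + (1 - p) * y) = (x + y) / c" for x y
      using assms by (simp add: C_def field_simps)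
    ultimately show ?thesis by simp
  qed
  have slower: "1 / g u \<le> ((1 + u) powr (- p) + (1 - u) powr (- p)) / c" if "- 1 < u" "u < 1" for u
  proof -
    let ?m = "min (1 - u) (1 + u)"
    have m: "?m > 0" using that by simp
    have "1 / g u \<le> 1 / (c * ?m powr p)"
      using lower[OF that] m \<open>c > 0\<close> by (intro divide_left_mono) (auto intro!: mult_pos_pos gpos that)
    also have "\<dots> = ?m powr (- p) / c" by (simp add: powr_minus field_simps)
    also have "\<dots> \<le> ((1 + u) powr (- p) + (1 - u) powr (- p)) / c"
      using \<open>c > 0\<close> by (intro divide_right_mono) (auto simp: min_def)
    finally show ?thesis .
  qed
  have incr: "K s - G s \<le> K t - G t" if "- 1 < s" "s \<le> t" "t < 1" for s t
  proof (rule DERIV_nonneg_imp_nondecreasing[where f = "\<lambda>u. K u - G u", OF \<open>s \<le> t\<close>])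
    fix u assume "s \<le> u" "u \<le> t"
    then have u: "- 1 < u" "u < 1" using that by auto
    show "\<exists>y. ((\<lambda>u. K u - G u) has_real_derivative y) (at u) \<and> 0 \<le> y"
      using DERIV_diff[OF K[OF u] G[OF u]] slower[OF u] by (auto intro!: exI)
  qed
  have mono: "G s \<le> G t" if "- 1 < s" "s \<le> t" "t < 1" for s t
  proof (rule DERIV_nonneg_imp_nondecreasing[where f = G, OF \<open>s \<le> t\<close>])
    fix u assume "s \<le> u" "u \<le> t"
    then have u: "- 1 < u" "u < 1" using that by auto
    show "\<exists>y. (G has_real_derivative y) (at u) \<and> 0 \<le> y"
      using G[OF u] gpos[OF u] by (auto intro!: exI less_imp_le)
  qed
  have G_0: "G 0 = 0" and K_0: "K 0 = 0" by (auto simp: G_def K_def)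
  have Kb: "\<bar>K u\<bar> \<le> C * 2" if "- 1 < u" "u < 1" for u
  proof -
    have "x powr (1 - p) \<le> 2" if "0 < x" "x < 2" for x :: real
    proof -
      have "x powr (1 - p) \<le> 2 powr (1 - p)" using that assms by (intro powr_mono2) auto
      also have "\<dots> \<le> 2 powr 1" using assms by (intro powr_mono) auto
      finally show ?thesis by simp
    qed
    then have "(1 + u) powr (1 - p) \<le> 2" "(1 - u) powr (1 - p) \<le> 2" using that by auto
    moreover have "0 \<le> (1 + u) powr (1 - p)" "0 \<le> (1 - u) powr (1 - p)" by auto
    ultimately have "\<bar>(1 + u) powr (1 - p) - (1 - u) powr (1 - p)\<bar> \<le> 2" by linarith
    then show ?thesis using C by (simp add: K_def abs_mult)
  qed
  show thesis
  proof (rule that[of G])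
    show "\<bar>G u\<bar> \<le> 2 / (c * (1 - p))" if u: "- 1 < u" "u < 1" for u
    proof (cases "u \<ge> 0")
      case True
      then show ?thesis using incr[of 0 u] mono[of 0 u] Kb[OF u] G_0 K_0 u by (simp add: C_def)
    next
      case False
      then show ?thesis using incr[of u 0] mono[of u 0] Kb[OF u] G_0 K_0 u by (simp add: C_def)
    qed
  qed (use G_0 G in auto)
qed

text \<open>The solution of \<open>\<psi>' = g \<psi>\<close> is the inverse of the travel time \<open>G\<close>, continued by the constants
\<open>- 1\<close> and \<open>1\<close>. The hypothesis on \<open>g'\<close> says that \<open>k = g * g'\<close>, so that \<open>\<psi>'' = k \<psi>\<close>. Because \<open>g\<close> and \<open>k\<close>
vanish at \<open>\<plusminus>1\<close>, both derivatives extend continuously across the two instants at which the profile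
arrives at \<open>\<plusminus>1\<close>, and hence the equations hold there as well.\<close>

lemma heteroclinic_profile:
  fixes g k :: "real \<Rightarrow> real"
  assumes contg: "continuous_on {- 1..1} g" and g1: "g 1 = 0" "g (- 1) = 0"
    and contk: "continuous_on {- 1..1} k" and k1: "k 1 = 0" "k (- 1) = 0"
    and dg: "\<And>u. - 1 < u \<Longrightarrow> u < 1 \<Longrightarrow> (g has_real_derivative k u / g u) (at u)"
    and c: "c > 0" and p: "0 < p" "p < 1"
    and lower: "\<And>u. - 1 < u \<Longrightarrow> u < 1 \<Longrightarrow> c * (min (1 - u) (1 + u)) powr p \<le> g u"
  obtains \<psi> where "\<And>x. \<psi> x \<in> {- 1..1}" "\<And>x. \<psi> x = 0 \<longleftrightarrow> x = 0"
    "\<And>x. x > 2 / (c * (1 - p)) \<Longrightarrow> \<psi> x = 1" "\<And>x. x < - (2 / (c * (1 - p))) \<Longrightarrow> \<psi> x = - 1"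
    "\<And>x. (\<psi> has_real_derivative g (\<psi> x)) (at x)"
    "\<And>x. ((\<lambda>x. g (\<psi> x)) has_real_derivative k (\<psi> x)) (at x)"
proof -
  define T where "T = 2 / (c * (1 - p))"
  have "continuous_on {- 1<..<1} g" by (rule continuous_on_subset[OF contg]) auto
  then obtain G where G_0: "G 0 = 0"
    and G: "\<And>u. - 1 < u \<Longrightarrow> u < 1 \<Longrightarrow> (G has_real_derivative 1 / g u) (at u)"
    and GT: "\<And>u. - 1 < u \<Longrightarrow> u < 1 \<Longrightarrow> \<bar>G u\<bar> \<le> T"
    using travel_time[OF _ c p lower] unfolding T_def by blast
  have gpos: "g u > 0" if "- 1 < u" "u < 1" for u
    using lower[OF that] that c by (auto intro: less_le_trans[rotated])
  have Gless: "G s < G t" if "- 1 < s" "s < t" "t < 1" for s t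
  proof (rule DERIV_pos_imp_increasing[OF \<open>s < t\<close>])
    fix u assume "s \<le> u" "u \<le> t"
    then have u: "- 1 < u" "u < 1" using that by auto
    show "\<exists>y. (G has_real_derivative y) (at u) \<and> 0 < y"
      using G[OF u] gpos[OF u] by (auto intro!: exI)
  qed
  have Gle: "s \<le> t" if "G s \<le> G t" "- 1 < s" "s < 1" "- 1 < t" "t < 1" for s t
    using Gless[of t s] that by (cases "t < s") auto
  \<comment> \<open>A generalized inverse of \<open>G\<close>. The extra point \<open>- 1\<close> supplies the value of the profile at times
    before the range of \<open>G\<close>; after that range the supremum is \<open>1\<close>.\<close>
  define S where "S = (\<lambda>x. insert (- 1) {u. - 1 < u \<and> u < 1 \<and> G u \<le> x})"
  define \<psi> where "\<psi> = (\<lambda>x. Sup (S x))"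
  have S_ne: "S x \<noteq> {}" and S_bdd: "bdd_above (S x)" for x
    by (auto simp: S_def intro!: bdd_aboveI[of _ 1])
  have range: "- 1 \<le> \<psi> x" "\<psi> x \<le> 1" for x
    unfolding \<psi>_def using S_ne S_bdd
    by (auto intro!: cSup_upper cSup_least simp: S_def)
  have "mono \<psi>"
    unfolding \<psi>_def by (intro monoI cSup_subset_mono S_ne S_bdd) (auto simp: S_def)
  have \<psi>G: "\<psi> (G u) = u" if "- 1 < u" "u < 1" for u
    unfolding \<psi>_def using that by (intro cSup_eq_maximum) (auto simp: S_def Gle)
  have cont\<psi>: "continuous_on UNIV \<psi>"
  proof (rule mono_onto_interval_imp_continuous[OF \<open>mono \<psi>\<close>])
    show "{- 1<..<1} \<subseteq> range \<psi>" using \<psi>G by (metis greaterThanLessThan_iff rangeI subsetI)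
    show "range \<psi> \<subseteq> {- 1..1}" using range by auto
  qed
  \<comment> \<open>\<open>A\<close> and \<open>B\<close> are the instants of departure from \<open>- 1\<close> and arrival at \<open>1\<close>.\<close>
  define B where "B = Sup (G ` {- 1<..<1})"
  define A where "A = Inf (G ` {- 1<..<1})"
  have bdd: "bdd_above (G ` {- 1<..<1})" "bdd_below (G ` {- 1<..<1})"
    using GT by (auto intro!: bdd_aboveI2[of _ _ T] bdd_belowI2[of _ "- T"] simp: abs_le_iff) force+
  have GB: "G u \<le> B" and AG: "A \<le> G u" if "- 1 < u" "u < 1" for u
    using that bdd by (auto simp: A_def B_def intro!: cSup_upper cInf_lower)
  have BT: "B \<le> T" "- T \<le> A"
    using GT by (auto simp: A_def B_def abs_le_iff intro!: cSup_least cInf_greatest) force+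
  have above: "\<psi> x = 1" if "x > B" for x
  proof -
    have "G u \<le> x" if "- 1 < u" "u < 1" for u using GB[OF that] \<open>x > B\<close> by simp
    then have "S x = {- 1..<1}" by (auto simp: S_def)
    then show ?thesis by (simp add: \<psi>_def)
  qed
  have below: "\<psi> x = - 1" if "x < A" for x
  proof -
    have "S x = {- 1}" using AG that by (fastforce simp: S_def)
    then show ?thesis by (simp add: \<psi>_def)
  qed
  have G\<psi>: "G (\<psi> x) = x \<and> - 1 < \<psi> x \<and> \<psi> x < 1" if x: "A < x" "x < B" for x
  proof -
    obtain u1 u2 where u: "- 1 < u1" "u1 < 1" "G u1 < x" "- 1 < u2" "u2 < 1" "x < G u2"
      using x bdd by (auto simp: A_def B_def cInf_less_iff less_cSup_iff)
    then have "u1 \<le> u2" using Gle by simp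
    moreover have "continuous_on {u1..u2} G"
      by (intro continuous_at_imp_continuous_on ballI DERIV_isCont[OF G]) (use u in auto)
    ultimately obtain w where "u1 \<le> w" "w \<le> u2" "G w = x"
      using IVT'[of G u1 x u2] u by auto
    then show ?thesis using \<psi>G[of w] u by auto
  qed
  have d\<psi>: "(\<psi> has_real_derivative g (\<psi> y)) (at y)"
    and dv: "((\<lambda>x. g (\<psi> x)) has_real_derivative k (\<psi> y)) (at y)" if "y \<notin> {A, B}" for y
  proof -
    consider "y < A" | "B < y" | "A < y" "y < B" using \<open>y \<notin> {A, B}\<close> by fastforce
    then have "(\<psi> has_real_derivative g (\<psi> y)) (at y) \<and>
      ((\<lambda>x. g (\<psi> x)) has_real_derivative k (\<psi> y)) (at y)"
    proof cases
      case 1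
      have "(\<psi> has_real_derivative 0) (at y)"
        by (rule has_field_derivative_transform_within_open[where S = "{..<A}" and f = "\<lambda>_. - 1"])
          (use 1 below in auto)
      moreover have "((\<lambda>x. g (\<psi> x)) has_real_derivative 0) (at y)"
        by (rule has_field_derivative_transform_within_open[where S = "{..<A}" and f = "\<lambda>_. 0"])
          (use 1 below g1 in auto)
      ultimately show ?thesis using below[OF 1] g1 k1 by simp
    next
      case 2
      have "(\<psi> has_real_derivative 0) (at y)"
        by (rule has_field_derivative_transform_within_open[where S = "{B<..}" and f = "\<lambda>_. 1"])
          (use 2 above in auto)
      moreover have "((\<lambda>x. g (\<psi> x)) has_real_derivative 0) (at y)"
        by (rule has_field_derivative_transform_within_open[where S = "{B<..}" and f = "\<lambda>_. 0"])
          (use 2 above g1 in auto)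
      ultimately show ?thesis using above[OF 2] g1 k1 by simp
    next
      case 3
      then have u: "- 1 < \<psi> y" "\<psi> y < 1" using G\<psi> by auto
      have "(\<psi> has_real_derivative inverse (1 / g (\<psi> y))) (at y)"
      proof (rule has_field_derivative_inverse_basic[where t = "{A<..<B}" and g = \<psi> and y = y, OF G[OF u]])
        show "1 / g (\<psi> y) \<noteq> 0" using gpos[OF u] by simp
        show "isCont \<psi> y" using cont\<psi> by (simp add: continuous_on_eq_continuous_at)
      qed (use 3 G\<psi> in auto)
      then have d: "(\<psi> has_real_derivative g (\<psi> y)) (at y)" by simp
      have "((\<lambda>x. g (\<psi> x)) has_real_derivative k (\<psi> y) / g (\<psi> y) * g (\<psi> y)) (at y)"
        by (rule DERIV_chain2[OF dg[OF u] d])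
      then show ?thesis using d gpos[OF u] by simp
    qed
    then show "(\<psi> has_real_derivative g (\<psi> y)) (at y)"
      "((\<lambda>x. g (\<psi> x)) has_real_derivative k (\<psi> y)) (at y)" by auto
  qed
  have contg\<psi>: "continuous_on UNIV (\<lambda>x. g (\<psi> x))"
    by (rule continuous_on_compose2[OF contg cont\<psi>]) (use range in auto)
  have contk\<psi>: "continuous_on UNIV (\<lambda>x. k (\<psi> x))"
    by (rule continuous_on_compose2[OF contk cont\<psi>]) (use range in auto)
  show thesis
  proof (rule that[of \<psi>])
    show "\<psi> x = 0 \<longleftrightarrow> x = 0" for x
    proof
      assume "x = 0"
      then show "\<psi> x = 0" using \<psi>G[of 0] G_0 by simp
    next
      assume 0: "\<psi> x = 0"
      have ends: "A < 0" "0 < B"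
        using Gless[of "- 1 / 2" 0] AG[of "- 1 / 2"] Gless[of 0 "1 / 2"] GB[of "1 / 2"] G_0 by auto
      show "x = 0"
      proof (rule ccontr)
        assume "x \<noteq> 0"
        have "\<not> (A < x \<and> x < B)" using G\<psi>[of x] 0 G_0 \<open>x \<noteq> 0\<close> by auto
        then consider "x \<le> A" | "x \<ge> B" by linarith
        then show False
        proof cases
          case 1
          have "G (- 1 / 2) \<ge> A" by (rule AG) auto
          then have "\<psi> x \<le> \<psi> (G (- 1 / 2))" using 1 by (intro monoD[OF \<open>mono \<psi>\<close>]) auto
          then show False using 0 \<psi>G[of "- 1 / 2"] by simp
        next
          case 2
          have "G (1 / 2) \<le> B" by (rule GB) auto
          then have "\<psi> x \<ge> \<psi> (G (1 / 2))" using 2 by (intro monoD[OF \<open>mono \<psi>\<close>]) auto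
          then show False using 0 \<psi>G[of "1 / 2"] by simp
        qed
      qed
    qed
    show "(\<psi> has_real_derivative g (\<psi> x)) (at x)" for x
      by (rule has_derivative_off_finite_set[of "{A, B}", OF _ cont\<psi> contg\<psi> d\<psi>]) auto
    show "((\<lambda>x. g (\<psi> x)) has_real_derivative k (\<psi> x)) (at x)" for x
      by (rule has_derivative_off_finite_set[of "{A, B}", OF _ contg\<psi> contk\<psi> dv]) auto
  qed (use range above below BT in \<open>auto simp: T_def\<close>)
qed

section \<open>A single transition layer\<close>

text \<open>The equation at one point, in the form solved for \<open>\<phi>''\<close>, together with its nondegeneracy there.
The pointwise form is a property of the germ of \<open>\<phi>\<close>, which is what makes gluing immediate.\<close>

definition steady_at ::
  "(real \<Rightarrow> real) \<Rightarrow> (real \<Rightarrow> real) \<Rightarrow> real \<Rightarrow> (real \<Rightarrow> real) \<Rightarrow> real \<Rightarrow> bool" where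
  "steady_at Q F \<epsilon> \<phi> x \<longleftrightarrow>
     (\<phi> has_real_derivative deriv \<phi> x) (at x) \<and>
     (deriv \<phi> has_real_derivative deriv F (\<phi> x) / (\<epsilon>\<^sup>2 * deriv Q (\<epsilon>\<^sup>2 * deriv \<phi> x))) (at x) \<and>
     deriv Q (\<epsilon>\<^sup>2 * deriv \<phi> x) > 0"

lemma steady_at_cong:
  assumes ev: "\<forall>\<^sub>F y in nhds x. \<phi> y = \<phi>' y" and "steady_at Q F \<epsilon> \<phi> x"
  shows "steady_at Q F \<epsilon> \<phi>' x"
proof -
  have "\<forall>\<^sub>F y in nhds x. \<forall>\<^sub>F z in nhds y. \<phi> z = \<phi>' z"
    using ev by (simp add: eventually_eventually)
  then have evd: "\<forall>\<^sub>F y in nhds x. deriv \<phi> y = deriv \<phi>' y"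
    by eventually_elim (rule deriv_cong_ev, auto)
  have "\<phi> x = \<phi>' x" "deriv \<phi> x = deriv \<phi>' x"
    using ev evd by (auto dest: eventually_nhds_x_imp_x)
  then show ?thesis
    using assms(2) DERIV_cong_ev[OF refl ev refl] DERIV_cong_ev[OF refl evd refl]
    unfolding steady_at_def by metis
qed

lemma flux_deriv_even:
  assumes "flux Q"
  shows "deriv Q (- s) = deriv Q s"
proof -
  have dQ: "(Q has_real_derivative deriv Q s) (at s)" for s
    using assms Ck_on_UNIV_deriv(1)[of 2 Q] by (auto simp: flux_def numeral_3_eq_3 numeral_2_eq_2)
  have "((\<lambda>x. Q (- x)) has_real_derivative - deriv Q (- s)) (at s)"
    using dQ[of "- s"] DERIV_mirror by blast
  moreover have "(\<lambda>x. Q (- x)) = (\<lambda>x. - Q x)" using assms by (auto simp: flux_def)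
  ultimately have "((\<lambda>x. - Q x) has_real_derivative - deriv Q (- s)) (at s)" by simp
  then show ?thesis using DERIV_minus[OF dQ[of s]] DERIV_unique by fastforce
qed

text \<open>Reflection changes the sign of \<open>\<phi>'\<close> and preserves \<open>\<phi>''\<close>; as \<open>Q'\<close> is even, decreasing layers are
reflected increasing ones.\<close>

lemma steady_at_reflect_shift:
  assumes "flux Q" and steady: "\<And>x. steady_at Q F \<epsilon> \<psi> x" and \<sigma>: "\<sigma> \<in> {1, - 1}"
  shows "steady_at Q F \<epsilon> (\<lambda>x. \<psi> (\<sigma> * (x - m))) x"
proof -
  let ?\<phi> = "\<lambda>x. \<psi> (\<sigma> * (x - m))"
  have inner: "((\<lambda>x. \<sigma> * (x - m)) has_real_derivative \<sigma>) (at x)" for x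
    by (auto intro!: derivative_eq_intros)
  have d: "(\<psi> has_real_derivative deriv \<psi> y) (at y)"
    and dd: "(deriv \<psi> has_real_derivative deriv F (\<psi> y) / (\<epsilon>\<^sup>2 * deriv Q (\<epsilon>\<^sup>2 * deriv \<psi> y))) (at y)"
    and pos: "deriv Q (\<epsilon>\<^sup>2 * deriv \<psi> y) > 0" for y
    using steady by (auto simp: steady_at_def)
  have d': "(?\<phi> has_real_derivative deriv \<psi> (\<sigma> * (x - m)) * \<sigma>) (at x)" for x
    by (rule DERIV_chain2[OF d inner])
  then have eq: "deriv ?\<phi> = (\<lambda>x. deriv \<psi> (\<sigma> * (x - m)) * \<sigma>)"
    by (intro ext DERIV_imp_deriv)
  have "(deriv ?\<phi> has_real_derivative
      deriv F (?\<phi> x) / (\<epsilon>\<^sup>2 * deriv Q (\<epsilon>\<^sup>2 * deriv \<psi> (\<sigma> * (x - m)))) * \<sigma> * \<sigma>) (at x)"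
    unfolding eq by (rule DERIV_cmult_right[OF DERIV_chain2[OF dd inner]])
  moreover have "\<sigma> * \<sigma> = 1" using \<sigma> by auto
  moreover have even: "deriv Q (\<epsilon>\<^sup>2 * (z * \<sigma>)) = deriv Q (\<epsilon>\<^sup>2 * z)" for z
    using \<sigma> flux_deriv_even[OF \<open>flux Q\<close>, of "\<epsilon>\<^sup>2 * z"] by auto
  ultimately show ?thesis
    using d' pos by (simp add: steady_at_def eq even mult.assoc)
qed

definition transition_layer ::
  "(real \<Rightarrow> real) \<Rightarrow> (real \<Rightarrow> real) \<Rightarrow> real \<Rightarrow> real \<Rightarrow> (real \<Rightarrow> real) \<Rightarrow> bool" where
  "transition_layer Q F \<epsilon> \<delta> \<psi> \<longleftrightarrow>
     (\<forall>x. steady_at Q F \<epsilon> \<psi> x) \<and> (\<forall>x. \<psi> x \<in> {- 1..1}) \<and> (\<forall>x. \<psi> x = 0 \<longleftrightarrow> x = 0) \<and>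
     (\<forall>x\<ge>\<delta>. \<psi> x = 1) \<and> (\<forall>x\<le>- \<delta>. \<psi> x = - 1)"

text \<open>With energy zero the first integral reads \<open>P (\<epsilon>\<^sup>2 * \<psi>') = \<epsilon>\<^sup>2 * F \<psi>\<close>, that is \<open>\<psi>' = g \<psi>\<close> with
\<open>g u = J (\<epsilon>\<^sup>2 * F u) / \<epsilon>\<^sup>2\<close>. The bounds on \<open>J\<close> and \<open>F\<close> give
\<open>g u \<ge> (const / \<epsilon>) * r powr (\<theta> / 2)\<close>, with \<open>r\<close> the distance to the nearer well. Since
\<open>\<theta> / 2 < 1\<close>, the layer touches both wells, and its width is proportional to \<open>\<epsilon>\<close>.\<close>

lemma layer_exists:
  assumes Q: "flux Q" and F: "double_well \<theta> F" and \<theta>: "0 < \<theta>" "\<theta> < 2" and "\<delta> > 0"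
  shows "\<exists>\<epsilon>\<^sub>0>0. \<forall>\<epsilon>\<in>{0<..<\<epsilon>\<^sub>0}. \<exists>\<psi>. transition_layer Q F \<epsilon> \<delta> \<psi>"
proof -
  obtain cF where cF: "cF > 0"
    and Flow: "\<And>u. u \<in> {- 1..1} \<Longrightarrow> cF * (min (1 - u) (1 + u)) powr \<theta> \<le> F u"
    by (rule double_well_lower_bound[OF F \<open>0 < \<theta>\<close>]) (rule that, assumption+)
  obtain J Y cQ where Y: "Y > 0" and cQ: "cQ > 0" and J0: "J 0 = 0"
    and contJ: "continuous_on {0..Y} J"
    and Jlow: "\<And>y. y \<in> {0..Y} \<Longrightarrow> cQ * sqrt y \<le> J y"
    and QJ: "\<And>y. y \<in> {0..Y} \<Longrightarrow> deriv Q (J y) > 0"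
    and dJ: "\<And>y. 0 < y \<Longrightarrow> y < Y \<Longrightarrow> (J has_real_derivative 1 / (J y * deriv Q (J y))) (at y)"
    by (rule flux_inverse_energy[OF Q]) (rule that, assumption+)
  have C1: "Ck_on (Suc 0) UNIV F" and Fpos: "\<And>u. u \<noteq> 1 \<Longrightarrow> u \<noteq> - 1 \<Longrightarrow> F u > 0"
    and F1: "F 1 = 0" "F (- 1) = 0" "deriv F 1 = 0" "deriv F (- 1) = 0"
    using F unfolding double_well_def by auto
  note dF = Ck_on_UNIV_deriv(1)[OF C1]
  have contF: "continuous_on S F" for S
    using dF by (meson DERIV_isCont continuous_at_imp_continuous_on)
  have contF': "continuous_on S (deriv F)" for S
    using Ck_on_UNIV_deriv(2)[OF C1] by (simp add: continuous_at_imp_continuous_on)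
  have contQ': "continuous_on S (deriv Q)" for S
    using Q Ck_on_UNIV_deriv(2)[of 2 Q]
    by (auto simp: flux_def numeral_3_eq_3 numeral_2_eq_2 continuous_at_imp_continuous_on)
  have Fnn: "F u \<ge> 0" for u using Fpos[of u] F1 by (cases "u = 1"; cases "u = - 1") auto
  have "\<exists>w\<in>{- 1..1}. \<forall>u\<in>{- 1..1}. F u \<le> F w"
    by (rule continuous_attains_sup) (auto simp: contF)
  then obtain w where w: "\<And>u. u \<in> {- 1..1} \<Longrightarrow> F u \<le> F w" by blast
  define K where "K = 2 / (cQ * sqrt cF * (1 - \<theta> / 2))"
  have K: "K > 0" using cQ cF \<theta> by (simp add: K_def)
  \<comment> \<open>The first bound keeps \<open>\<epsilon>\<^sup>2 * F\<close> in the domain of \<open>J\<close>, the second makes the half-width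
    \<open>\<epsilon> * K\<close> of the layer less than \<open>\<delta>\<close>.\<close>
  define \<epsilon>\<^sub>0 where "\<epsilon>\<^sub>0 = min (sqrt (Y / (F w + 1))) (\<delta> / K)"
  have "\<epsilon>\<^sub>0 > 0" using Y Fnn[of w] K \<open>\<delta> > 0\<close> by (auto simp: \<epsilon>\<^sub>0_def)
  moreover have "\<exists>\<psi>. transition_layer Q F \<epsilon> \<delta> \<psi>"
    if \<epsilon>: "\<epsilon> \<in> {0<..<\<epsilon>\<^sub>0}" for \<epsilon>
  proof -
    have "\<epsilon> > 0" using \<epsilon> by simp
    have "\<epsilon> < sqrt (Y / (F w + 1))" using \<epsilon> by (simp add: \<epsilon>\<^sub>0_def)
    then have "\<epsilon>\<^sup>2 < (sqrt (Y / (F w + 1)))\<^sup>2" using \<open>\<epsilon> > 0\<close> by (intro power_strict_mono) auto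
    then have "\<epsilon>\<^sup>2 * F w + \<epsilon>\<^sup>2 < Y" using Y Fnn[of w] by (simp add: field_simps)
    moreover have "\<epsilon>\<^sup>2 > 0" using \<open>\<epsilon> > 0\<close> by simp
    ultimately have small: "\<epsilon>\<^sup>2 * F w < Y" by linarith
    have yY: "\<epsilon>\<^sup>2 * F u < Y" if "u \<in> {- 1..1}" for u
      using mult_left_mono[OF w[OF that], of "\<epsilon>\<^sup>2"] small by simp
    have y: "\<epsilon>\<^sup>2 * F u \<in> {0..Y}" if "u \<in> {- 1..1}" for u
      using yY[OF that] Fnn[of u] by simp
    define g where "g = (\<lambda>u. J (\<epsilon>\<^sup>2 * F u) / \<epsilon>\<^sup>2)"
    define k where "k = (\<lambda>u. deriv F u / (\<epsilon>\<^sup>2 * deriv Q (J (\<epsilon>\<^sup>2 * F u))))"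
    have contJF: "continuous_on {- 1..1} (\<lambda>u. J (\<epsilon>\<^sup>2 * F u))"
      by (rule continuous_on_compose2[OF contJ]) (use y in \<open>auto intro!: continuous_intros contF\<close>)
    define c where "c = cQ * sqrt cF / \<epsilon>"
    have c: "c > 0" using cQ cF \<open>\<epsilon> > 0\<close> by (simp add: c_def)
    have time: "2 / (c * (1 - \<theta> / 2)) < \<delta>"
    proof -
      have "2 / (c * (1 - \<theta> / 2)) = \<epsilon> * K" by (simp add: c_def K_def)
      also have "\<dots> < \<delta>" using \<epsilon> K by (simp add: \<epsilon>\<^sub>0_def field_simps)
      finally show ?thesis .
    qed
    have low: "c * (min (1 - u) (1 + u)) powr (\<theta> / 2) \<le> g u" if "- 1 < u" "u < 1" for u
    proof -
      let ?m = "min (1 - u) (1 + u)"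
      have u: "u \<in> {- 1..1}" using that by simp
      have "sqrt (?m powr \<theta>) = ?m powr (\<theta> / 2)"
        using that by (simp add: powr_half_sqrt[symmetric] powr_powr)
      then have "cQ * (\<epsilon> * (sqrt cF * ?m powr (\<theta> / 2))) = cQ * sqrt (\<epsilon>\<^sup>2 * (cF * ?m powr \<theta>))"
        using \<open>\<epsilon> > 0\<close> by (simp add: real_sqrt_mult)
      also have "\<dots> \<le> cQ * sqrt (\<epsilon>\<^sup>2 * F u)"
        using Flow[OF u] cQ by (intro mult_left_mono real_sqrt_le_mono) auto
      also have "\<dots> \<le> J (\<epsilon>\<^sup>2 * F u)" by (rule Jlow[OF y[OF u]])
      finally have "cQ * (\<epsilon> * (sqrt cF * ?m powr (\<theta> / 2))) / \<epsilon>\<^sup>2 \<le> g u"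
        unfolding g_def by (rule divide_right_mono) simp
      then show ?thesis using \<open>\<epsilon> > 0\<close> by (simp add: c_def power2_eq_square mult.assoc)
    qed
    have dg: "(g has_real_derivative k u / g u) (at u)" if "- 1 < u" "u < 1" for u
    proof -
      have u: "u \<in> {- 1..1}" using that by simp
      have "0 < g u" using low[OF that] c that by (auto intro: less_le_trans[rotated])
      then have Jnz: "J (\<epsilon>\<^sup>2 * F u) \<noteq> 0" by (auto simp: g_def)
      have Qnz: "deriv Q (J (\<epsilon>\<^sup>2 * F u)) \<noteq> 0" using QJ[OF y[OF u]] by simp
      have "0 < \<epsilon>\<^sup>2 * F u" using Fpos[of u] that \<open>\<epsilon> > 0\<close> by simp
      then have "((\<lambda>u. J (\<epsilon>\<^sup>2 * F u)) has_real_derivative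
          1 / (J (\<epsilon>\<^sup>2 * F u) * deriv Q (J (\<epsilon>\<^sup>2 * F u))) * (\<epsilon>\<^sup>2 * deriv F u)) (at u)"
        by (intro DERIV_chain2[OF dJ] DERIV_cmult dF yY u)
      then have "(g has_real_derivative
          1 / (J (\<epsilon>\<^sup>2 * F u) * deriv Q (J (\<epsilon>\<^sup>2 * F u))) * (\<epsilon>\<^sup>2 * deriv F u) / \<epsilon>\<^sup>2) (at u)"
        unfolding g_def by (rule DERIV_cdivide)
      moreover have "1 / (J (\<epsilon>\<^sup>2 * F u) * deriv Q (J (\<epsilon>\<^sup>2 * F u))) * (\<epsilon>\<^sup>2 * deriv F u) / \<epsilon>\<^sup>2 = k u / g u"
        using Jnz Qnz \<open>\<epsilon> > 0\<close> by (simp add: g_def k_def field_simps)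
      ultimately show ?thesis by simp
    qed
    have contg: "continuous_on {- 1..1} g"
      unfolding g_def using \<open>\<epsilon> > 0\<close> by (intro continuous_intros contJF) auto
    have contk: "continuous_on {- 1..1} k"
      unfolding k_def using \<open>\<epsilon> > 0\<close> QJ[OF y]
      by (intro continuous_intros contF' continuous_on_compose2[OF contQ'[of UNIV] contJF]) force+
    obtain \<psi> where \<psi>: "\<And>x. \<psi> x \<in> {- 1..1}" "\<And>x. \<psi> x = 0 \<longleftrightarrow> x = 0"
      "\<And>x. x > 2 / (c * (1 - \<theta> / 2)) \<Longrightarrow> \<psi> x = 1" "\<And>x. x < - (2 / (c * (1 - \<theta> / 2))) \<Longrightarrow> \<psi> x = - 1"
      and d\<psi>: "\<And>x. (\<psi> has_real_derivative g (\<psi> x)) (at x)"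
      and dv: "\<And>x. ((\<lambda>x. g (\<psi> x)) has_real_derivative k (\<psi> x)) (at x)"
    proof (rule heteroclinic_profile[OF contg _ _ contk _ _ dg c _ _ low])
      show "g 1 = 0" "g (- 1) = 0" "k 1 = 0" "k (- 1) = 0"
        using F1 J0 by (auto simp: g_def k_def)
    qed (use \<theta> in auto)
    have deriv_\<psi>: "deriv \<psi> = (\<lambda>x. g (\<psi> x))" using d\<psi> by (auto simp: DERIV_imp_deriv)
    have "\<epsilon>\<^sup>2 * g u = J (\<epsilon>\<^sup>2 * F u)" for u using \<open>\<epsilon> > 0\<close> by (simp add: g_def)
    then have "steady_at Q F \<epsilon> \<psi> x" for x
      using d\<psi>[of x] dv[of x] QJ[OF y[OF \<psi>(1)[of x]]] by (simp add: steady_at_def deriv_\<psi> k_def)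
    then show ?thesis using \<psi> time by (intro exI[of _ \<psi>]) (auto simp: transition_layer_def)
  qed
  ultimately show ?thesis by blast
qed

section \<open>Chains of layers\<close>

text \<open>The last conjunct describes the plateau number \<open>i\<close>, which lies between the layers at \<open>h i\<close> and
\<open>h (Suc i)\<close>. Its guards make the plateaus \<open>0\<close> and \<open>n\<close> unbounded, so that \<open>h 0\<close> and \<open>h (Suc n)\<close>
never enter.\<close>

definition layer_chain ::
  "(real \<Rightarrow> real) \<Rightarrow> (real \<Rightarrow> real) \<Rightarrow> real \<Rightarrow> real \<Rightarrow> (nat \<Rightarrow> real) \<Rightarrow> nat \<Rightarrow> real \<Rightarrow>
    (real \<Rightarrow> real) \<Rightarrow> bool" where
  "layer_chain Q F \<epsilon> \<delta> h n c \<phi> \<longleftrightarrow>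
     (\<forall>x. steady_at Q F \<epsilon> \<phi> x) \<and> (\<forall>x. \<phi> x \<in> {- 1..1}) \<and> {x. \<phi> x = 0} = h ` {1..n} \<and>
     (\<forall>i\<le>n. \<forall>x. (1 \<le> i \<longrightarrow> h i + \<delta> \<le> x) \<longrightarrow> (i < n \<longrightarrow> x \<le> h (Suc i) - \<delta>) \<longrightarrow>
        \<phi> x = (- 1) ^ i * c)"

lemma layer_chainD:
  assumes "layer_chain Q F \<epsilon> \<delta> h n c \<phi>"
  shows "steady_at Q F \<epsilon> \<phi> x" and "\<phi> x \<in> {- 1..1}" and "{x. \<phi> x = 0} = h ` {1..n}"
    and "i \<le> n \<Longrightarrow> (1 \<le> i \<Longrightarrow> h i + \<delta> \<le> x) \<Longrightarrow> (i < n \<Longrightarrow> x \<le> h (Suc i) - \<delta>) \<Longrightarrow>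
      \<phi> x = (- 1) ^ i * c"
proof -
  note chain = assms[unfolded layer_chain_def]
  show "steady_at Q F \<epsilon> \<phi> x" "\<phi> x \<in> {- 1..1}" "{x. \<phi> x = 0} = h ` {1..n}"
    using chain by (elim conjE; blast)+
  show "\<phi> x = (- 1) ^ i * c"
    if "i \<le> n" "1 \<le> i \<Longrightarrow> h i + \<delta> \<le> x" "i < n \<Longrightarrow> x \<le> h (Suc i) - \<delta>"
    using chain that by blast
qed

text \<open>The next layer is attached to a shorter chain by switching functions at \<open>h (Suc n) - \<delta>\<close>. The
shorter chain and the new layer are both equal to the same constant on an open interval to the left
of that point; hence near every point the new function coincides with one of the two.\<close>

lemma chain_of_layers:
  assumes "flux Q" and "\<delta> > 0" and c: "c \<in> {1, - 1}"
    and layer: "transition_layer Q F \<epsilon> \<delta> \<psi>"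
    and rest: "\<And>x. steady_at Q F \<epsilon> (\<lambda>_. c) x"
    and gap: "\<And>i. 1 \<le> i \<Longrightarrow> i < n \<Longrightarrow> h i + \<delta> < h (Suc i) - \<delta>"
  shows "\<exists>\<phi>. layer_chain Q F \<epsilon> \<delta> h n c \<phi>"
  using gap
proof (induction n)
  case 0
  show ?case using c rest by (intro exI[of _ "\<lambda>_. c"]) (auto simp: layer_chain_def)
next
  case (Suc n)
  have "\<exists>\<phi>. layer_chain Q F \<epsilon> \<delta> h n c \<phi>"
    by (rule Suc.IH) (use Suc.prems in auto)
  then obtain \<phi> where chain: "layer_chain Q F \<epsilon> \<delta> h n c \<phi>" ..
  note \<phi> = layer_chainD(1-3)[OF chain] and plateau = layer_chainD(4)[OF chain]
  have steady: "steady_at Q F \<epsilon> \<psi> x" and range: "\<psi> x \<in> {- 1..1}" and zero: "\<psi> x = 0 \<longleftrightarrow> x = 0"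
    and right: "x \<ge> \<delta> \<Longrightarrow> \<psi> x = 1" and left: "x \<le> - \<delta> \<Longrightarrow> \<psi> x = - 1" for x
    using layer by (simp_all add: transition_layer_def)
  \<comment> \<open>\<open>d\<close> is the final value of the shorter chain; the new layer descends if \<open>d = 1\<close> and ascends if
    \<open>d = - 1\<close>.\<close>
  define d where "d = (- 1) ^ n * c"
  have d: "d \<in> {1, - 1}" using c by (cases "even n") (auto simp: d_def)
  define m where "m = h (Suc n) - \<delta>"
  define \<xi> where "\<xi> = (\<lambda>x. \<psi> (- d * (x - h (Suc n))))"
  have \<xi>: "steady_at Q F \<epsilon> \<xi> x" "\<xi> x \<in> {- 1..1}" "\<xi> x = 0 \<longleftrightarrow> x = h (Suc n)" for x
    using d steady_at_reflect_shift[OF \<open>flux Q\<close> steady, of "- d"] range zero by (auto simp: \<xi>_def)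
  have \<xi>_left: "\<xi> x = d" if "x \<le> m" for x
    using that d right left by (auto simp: \<xi>_def m_def)
  have \<xi>_right: "\<xi> x = - d" if "x \<ge> h (Suc n) + \<delta>" for x
    using that d right left by (auto simp: \<xi>_def)
  have last_gap: "h n + \<delta> < m" if "1 \<le> n" using Suc.prems[of n] that by (simp add: m_def)
  have mono_h: "h (Suc i) \<le> h n" if "i < n" for i
    using \<open>i < n\<close>
  proof (induction rule: strict_inc_induct)
    case (step j)
    then show ?case using Suc.prems[of "Suc j"] \<open>\<delta> > 0\<close> by auto
  qed simp
  define \<phi>' where "\<phi>' = (\<lambda>x. if x \<le> m then \<phi> x else \<xi> x)"
  obtain l where l: "l < m" "\<And>x. l < x \<Longrightarrow> \<phi> x = d"
  proof (cases "1 \<le> n")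
    case True
    then show ?thesis using that[of "h n + \<delta>"] last_gap plateau[of n] by (auto simp: d_def)
  next
    case False
    then show ?thesis using that[of "m - 1"] plateau[of n] by (auto simp: d_def)
  qed
  have "steady_at Q F \<epsilon> \<phi>' x" for x
  proof (cases "x < m")
    case True
    have "\<forall>\<^sub>F y in nhds x. \<phi> y = \<phi>' y"
      using eventually_nhds_in_open[of "{..<m}" x] True by (auto elim!: eventually_mono simp: \<phi>'_def)
    then show ?thesis by (rule steady_at_cong[OF _ \<phi>(1)])
  next
    case False
    have "\<forall>\<^sub>F y in nhds x. \<xi> y = \<phi>' y"
      using eventually_nhds_in_open[of "{l<..}" x] False l \<xi>_left
      by (auto elim!: eventually_mono simp: \<phi>'_def)
    then show ?thesis by (rule steady_at_cong[OF _ \<xi>(1)])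
  qed
  moreover have "\<phi>' x \<in> {- 1..1}" for x
    using \<phi>(2) \<xi>(2) by (simp add: \<phi>'_def)
  moreover have "{x. \<phi>' x = 0} = h ` {1..Suc n}"
  proof -
    have h_le: "h i \<le> m" if "i \<in> {1..n}" for i
      using mono_h[of "i - 1"] last_gap \<open>\<delta> > 0\<close> that by (cases i) auto
    have "x \<le> m" if "\<phi> x = 0" for x
    proof -
      have "x \<in> h ` {1..n}" using that \<phi>(3) by blast
      then show ?thesis using h_le by blast
    qed
    moreover have "h (Suc n) > m" using \<open>\<delta> > 0\<close> by (simp add: m_def)
    ultimately have "\<phi>' x = 0 \<longleftrightarrow> x = h (Suc n) \<or> \<phi> x = 0" for x
      using \<xi>(3)[of x] by (cases "x \<le> m") (auto simp: \<phi>'_def)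
    then have "{x. \<phi>' x = 0} = insert (h (Suc n)) {x. \<phi> x = 0}" by auto
    then show ?thesis using \<phi>(3) by (simp add: atLeastAtMostSuc_conv)
  qed
  moreover have "\<phi>' x = (- 1) ^ i * c"
    if i: "i \<le> Suc n" "1 \<le> i \<longrightarrow> h i + \<delta> \<le> x" "i < Suc n \<longrightarrow> x \<le> h (Suc i) - \<delta>" for i x
  proof (cases "i = Suc n")
    case True
    then show ?thesis using i \<xi>_right[of x] \<open>\<delta> > 0\<close> by (simp add: \<phi>'_def m_def d_def)
  next
    case False
    then have "i \<le> n" using i by simp
    moreover have "x \<le> m"
      using i False mono_h[of i] last_gap \<open>\<delta> > 0\<close> by (cases "i = n") (auto simp: m_def)
    ultimately show ?thesis using plateau[of i x] i by (simp add: \<phi>'_def)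
  qed
  ultimately show ?case unfolding layer_chain_def by (intro exI[of _ \<phi>'] conjI allI impI) simp_all
qed

section \<open>Solutions of the Neumann problem\<close>

lemma steady_at_imp_classical_solution:
  assumes Q: "Ck_on (Suc n) UNIV Q" and F: "Ck_on (Suc 0) UNIV F" and "\<epsilon> \<noteq> 0"
    and steady: "\<And>x. steady_at Q F \<epsilon> \<phi> x" and ends: "deriv \<phi> a = 0" "deriv \<phi> b = 0"
  shows "classical_solution Q F \<epsilon> a b \<phi>"
proof -
  define A where "A = (\<lambda>x. deriv F (\<phi> x) / (\<epsilon>\<^sup>2 * deriv Q (\<epsilon>\<^sup>2 * deriv \<phi> x)))"
  have d: "(\<phi> has_real_derivative deriv \<phi> x) (at x)"
    and dd: "(deriv \<phi> has_real_derivative A x) (at x)"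
    and pos: "deriv Q (\<epsilon>\<^sup>2 * deriv \<phi> x) > 0" for x
    using steady unfolding steady_at_def A_def by auto
  have "isCont A x" for x
    unfolding A_def
  proof (intro continuous_intros)
    show "isCont (\<lambda>x. deriv F (\<phi> x)) x"
      by (rule isCont_o2[OF DERIV_isCont[OF d] Ck_on_UNIV_deriv(2)[OF F]])
    have "isCont (\<lambda>x. \<epsilon>\<^sup>2 * deriv \<phi> x) x" using DERIV_isCont[OF dd] by (intro continuous_intros)
    then show "isCont (\<lambda>x. deriv Q (\<epsilon>\<^sup>2 * deriv \<phi> x)) x"
      by (rule isCont_o2[OF _ Ck_on_UNIV_deriv(2)[OF Q]])
    show "\<epsilon>\<^sup>2 * deriv Q (\<epsilon>\<^sup>2 * deriv \<phi> x) \<noteq> 0" using \<open>\<epsilon> \<noteq> 0\<close> pos[of x] by simp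
  qed
  then have "Ck_on 2 {a..b} \<phi>"
    unfolding Ck_on_def using d dd
    by (intro exI[of _ "\<lambda>i. if i = 0 then \<phi> else if i = 1 then deriv \<phi> else A"])
      (auto simp: less_2_cases_iff intro: has_field_derivative_at_within continuous_at_imp_continuous_on)
  moreover have "((\<lambda>y. Q (\<epsilon>\<^sup>2 * deriv \<phi> y)) has_real_derivative deriv F (\<phi> x)) (at x)" for x
  proof -
    have "((\<lambda>y. Q (\<epsilon>\<^sup>2 * deriv \<phi> y)) has_real_derivative deriv Q (\<epsilon>\<^sup>2 * deriv \<phi> x) * (\<epsilon>\<^sup>2 * A x)) (at x)"
      by (intro DERIV_chain2[OF Ck_on_UNIV_deriv(1)[OF Q]] DERIV_cmult dd)
    then show ?thesis using \<open>\<epsilon> \<noteq> 0\<close> pos[of x] by (simp add: A_def)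
  qed
  ultimately show ?thesis
    using d[of a] d[of b] ends unfolding classical_solution_def
    by (auto intro: has_field_derivative_at_within simp: DERIV_imp_deriv real_differentiable_def)
qed

text \<open>A chain is constant near \<open>a\<close> and near \<open>b\<close>, which gives the Neumann conditions. The value \<open>\<plusminus>1\<close>
prescribed between two consecutive zeros is attained at the left end of the plateau.\<close>

lemma oscillating_solution:
  assumes Q: "flux Q" and F: "double_well \<theta> F" and "\<epsilon> \<noteq> 0" and "\<delta> > 0" and c: "c \<in> {1, - 1}"
    and layer: "transition_layer Q F \<epsilon> \<delta> \<psi>"
    and gap: "\<And>i. i \<le> N \<Longrightarrow> node a b N h i + 3 * \<delta> \<le> node a b N h (Suc i)"
    and inside: "\<And>i. i \<in> {1..N} \<Longrightarrow> a < h i \<and> h i < b"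
  shows "\<exists>\<phi>. classical_solution Q F \<epsilon> a b \<phi> \<and> oscillates_from c a b N h \<phi> \<and>
    {x \<in> {a..b}. \<phi> x = 0} = h ` {1..N}"
proof -
  have rest: "steady_at Q F \<epsilon> (\<lambda>_. c) x" for x
  proof -
    have "deriv Q 0 > 0" using Q by (auto simp: flux_def)
    moreover have "deriv F c = 0" using F c by (auto simp: double_well_def)
    moreover have "deriv (\<lambda>_. c) = (\<lambda>_. 0)" by auto
    ultimately show ?thesis by (simp add: steady_at_def)
  qed
  have hgap: "h i + \<delta> < h (Suc i) - \<delta>" if "1 \<le> i" "i < N" for i
    using gap[of i] that \<open>\<delta> > 0\<close> by (simp add: node_def)
  obtain \<phi> where chain: "layer_chain Q F \<epsilon> \<delta> h N c \<phi>"
    using chain_of_layers[where h = h and n = N, OF Q \<open>\<delta> > 0\<close> c layer rest hgap] by blast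
  note \<phi> = layer_chainD(1-3)[OF chain] and plateau = layer_chainD(4)[OF chain]
  have at_a: "\<phi> x = c" if "x \<le> a + \<delta>" for x
    using plateau[of 0 x] gap[of 0] that \<open>\<delta> > 0\<close> by (auto simp: node_def Suc_le_eq split: if_splits)
  have at_b: "\<phi> x = (- 1) ^ N * c" if "x \<ge> b - \<delta>" for x
    using plateau[of N x] gap[of N] that \<open>\<delta> > 0\<close> by (auto simp: node_def split: if_splits)
  have "(\<phi> has_real_derivative 0) (at a)"
    by (rule has_field_derivative_transform_within_open[where S = "{..<a + \<delta>}" and f = "\<lambda>_. c"])
      (use at_a \<open>\<delta> > 0\<close> in auto)
  then have "deriv \<phi> a = 0" by (rule DERIV_imp_deriv)
  have "(\<phi> has_real_derivative 0) (at b)"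
    by (rule has_field_derivative_transform_within_open[where S = "{b - \<delta><..}" and f = "\<lambda>_. (- 1) ^ N * c"])
      (use at_b \<open>\<delta> > 0\<close> in auto)
  then have "deriv \<phi> b = 0" by (rule DERIV_imp_deriv)
  have "classical_solution Q F \<epsilon> a b \<phi>"
  proof (rule steady_at_imp_classical_solution[of 2])
    show "Ck_on (Suc 2) UNIV Q" using Q by (simp add: flux_def numeral_3_eq_3 numeral_2_eq_2)
    show "Ck_on (Suc 0) UNIV F" using F by (simp add: double_well_def)
  qed fact+
  moreover have "oscillates_from c a b N h \<phi>"
    unfolding oscillates_from_def
  proof (intro conjI allI impI ballI)
    show "\<phi> a = c" using at_a \<open>\<delta> > 0\<close> by simp
    show "\<phi> x \<in> {- 1..1}" for x by (rule \<phi>(2))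
    fix i assume i: "i \<le> N"
    show "\<exists>x\<in>{node a b N h i..node a b N h (Suc i)}. \<phi> x = (- 1) ^ i * c"
    proof (cases "i = 0")
      case True
      then show ?thesis using at_a[of a] gap[of 0] \<open>\<delta> > 0\<close> by (intro bexI[of _ a]) (auto simp: node_def)
    next
      case False
      have "\<phi> (h i + \<delta>) = (- 1) ^ i * c"
        using hgap[of i] i False by (intro plateau) auto
      moreover have "node a b N h i = h i" using i False by (simp add: node_def)
      ultimately show ?thesis
        using gap[OF i] \<open>\<delta> > 0\<close> by (intro bexI[of _ "h i + \<delta>"]) auto
    qed
  qed
  moreover have "{x \<in> {a..b}. \<phi> x = 0} = h ` {1..N}"
  proof -
    have "h ` {1..N} \<subseteq> {a..b}" using inside by (intro image_subsetI) (simp add: less_imp_le)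
    then show ?thesis using \<phi>(3) by blast
  qed
  ultimately show ?thesis by blast
qed

theorem proposition7:
  fixes a b \<theta> :: real and Q F :: "real \<Rightarrow> real" and N :: nat and h :: "nat \<Rightarrow> real"
  assumes "a < b"
    and "flux Q"
    and "1 < \<theta>" and "\<theta> < 2"
    and "double_well \<theta> F"
    and "strict_mono_on {1..N} h"
    and "\<forall>i\<in>{1..N}. a < h i \<and> h i < b"
  shows "\<exists>\<epsilon>\<^sub>0>0. \<forall>\<epsilon>\<in>{0<..<\<epsilon>\<^sub>0}. \<exists>\<phi>\<^sub>1 \<phi>\<^sub>2.
           classical_solution Q F \<epsilon> a b \<phi>\<^sub>1 \<and>
           oscillates_from (- 1) a b N h \<phi>\<^sub>1 \<and>
           {x \<in> {a..b}. \<phi>\<^sub>1 x = 0} = h ` {1..N} \<and>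
           classical_solution Q F \<epsilon> a b \<phi>\<^sub>2 \<and>
           oscillates_from 1 a b N h \<phi>\<^sub>2 \<and>
           {x \<in> {a..b}. \<phi>\<^sub>2 x = 0} = h ` {1..N}"
proof -
  let ?gaps = "(\<lambda>i. node a b N h (Suc i) - node a b N h i) ` {..N}"
  \<comment> \<open>A third of the smallest gap: the half-widths of two neighbouring layers and a plateau between
    them fit into every gap.\<close>
  define \<delta> where "\<delta> = Min ?gaps / 3"
  have "node a b N h i < node a b N h (Suc i)" if "i \<le> N" for i
    using that assms(1,7) strict_mono_onD[OF assms(6), of i "Suc i"] by (auto simp: node_def)
  then have "\<delta> > 0" by (auto simp: \<delta>_def Min_gr_iff)
  have gap: "node a b N h i + 3 * \<delta> \<le> node a b N h (Suc i)" if "i \<le> N" for i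
  proof -
    have "Min ?gaps \<le> node a b N h (Suc i) - node a b N h i" using that by (intro Min_le) auto
    then show ?thesis by (simp add: \<delta>_def)
  qed
  have "0 < \<theta>" using assms(3) by simp
  from layer_exists[OF assms(2,5) this assms(4) \<open>\<delta> > 0\<close>]
  obtain \<epsilon>\<^sub>0 where "\<epsilon>\<^sub>0 > 0"
    and layer: "\<forall>\<epsilon>\<in>{0<..<\<epsilon>\<^sub>0}. \<exists>\<psi>. transition_layer Q F \<epsilon> \<delta> \<psi>" by blast
  have sol: "\<exists>\<phi>. classical_solution Q F \<epsilon> a b \<phi> \<and> oscillates_from c a b N h \<phi> \<and>
      {x \<in> {a..b}. \<phi> x = 0} = h ` {1..N}" if \<epsilon>: "\<epsilon> \<in> {0<..<\<epsilon>\<^sub>0}" and c: "c \<in> {1, - 1}" for \<epsilon> c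
  proof -
    obtain \<psi> where "transition_layer Q F \<epsilon> \<delta> \<psi>"
      using layer \<epsilon> by blast
    moreover have "\<epsilon> \<noteq> 0" using \<epsilon> by simp
    ultimately show ?thesis
      using assms(2,5,7) \<open>\<delta> > 0\<close> c gap by (intro oscillating_solution) auto
  qed
  show ?thesis
  proof (intro exI[of _ \<epsilon>\<^sub>0] conjI ballI)
    show "\<epsilon>\<^sub>0 > 0" by fact
    fix \<epsilon> assume \<epsilon>: "\<epsilon> \<in> {0<..<\<epsilon>\<^sub>0}"
    obtain \<phi>\<^sub>1 where "classical_solution Q F \<epsilon> a b \<phi>\<^sub>1" "oscillates_from (- 1) a b N h \<phi>\<^sub>1"
      "{x \<in> {a..b}. \<phi>\<^sub>1 x = 0} = h ` {1..N}"
      using sol[OF \<epsilon>, of "- 1"] by auto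
    moreover obtain \<phi>\<^sub>2 where "classical_solution Q F \<epsilon> a b \<phi>\<^sub>2" "oscillates_from 1 a b N h \<phi>\<^sub>2"
      "{x \<in> {a..b}. \<phi>\<^sub>2 x = 0} = h ` {1..N}"
      using sol[OF \<epsilon>, of 1] by auto
    ultimately show "\<exists>\<phi>\<^sub>1 \<phi>\<^sub>2.
           classical_solution Q F \<epsilon> a b \<phi>\<^sub>1 \<and>
           oscillates_from (- 1) a b N h \<phi>\<^sub>1 \<and>
           {x \<in> {a..b}. \<phi>\<^sub>1 x = 0} = h ` {1..N} \<and>
           classical_solution Q F \<epsilon> a b \<phi>\<^sub>2 \<and>
           oscillates_from 1 a b N h \<phi>\<^sub>2 \<and>
           {x \<in> {a..b}. \<phi>\<^sub>2 x = 0} = h ` {1..N}"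
      by blast
  qed
qed

end
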